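(* (i) For each CP-net $N$, the CP-net $N$ and its reduced form $N' = r(N)$ have the same ordering $\succ$ over the outcomes. (ii) For each CP-net $N$ and its reduced form $N' = r(N)$ we have $\mathcal{G}(N) = \mathcal{G}(N')$. (iii) For each reduced CP-net $N$ we have $N = r(\mathcal{N}(\mathcal{G}(N)))$.
   Context: A preference on a set $A$ is a strict linear ordering on $A$. **CP-nets.** A CP-net consists of variables $X_1,\ldots,X_n$ with finite non-empty domains $\mathcal{D}(X_i)$; for each $i$ a (possibly empty) set of parents $Pa(X_i) = \{X_{i_1},\ldots,X_{i_k}\} \subseteq \{X_1,\ldots,X_n\}\setminus\{X_i\}$, with index sequence $I = i_1,\ldots,i_k$; and for each $i$ and each complete assignment $a_I \in \mathcal{D}(X_{i_1})\times\cdots\times\mathcal{D}(X_{i_k})$ exactly one preference statement $X_I = a_I : \succ(a_I)$, where $\succ(a_I)$ is a preference on $\mathcal{D}(X_i)$. An outcome is an element of $\mathcal{D}(X_1)\times\cdots\times\mathcal{D}(X_n)$. A worsening flip is a transition from an outcome $\alpha$ to an outcome $\beta$ that differ in the value of a single variable $X_i$, where $\alpha_i$ is preferred to $\beta_i$ in the unique preference statement for $X_i$ determined by the (common) values of $\alpha,\beta$ on $Pa(X_i)$. The ordering over outcomes is: $\alpha\succ\beta$ iff there is a chain of (one or more) worsening flips from $\alpha$ to $\beta$. **Reduction.** A variable $Y\in Pa(X_i)$ is redundant in the set of parents of $X_i$ if for all assignments $a$ to $Pa(X_i)\setminus\{Y\}$ and any two values $y_1,y_2\in\mathcal{D}(Y)$,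 the orderings $\succ(a,y_1)$ and $\succ(a,y_2)$ on $\mathcal{D}(X_i)$ coincide. A redundant $Y$ can be removed from $Pa(X_i)$, the preference statements for $X_i$ being modified accordingly: the ordering for an assignment $a$ to $Pa(X_i)\setminus\{Y\}$ is the common ordering $\succ(a,y)$, $y\in\mathcal{D}(Y)$. A CP-net is reduced if for no variable $X_i$ does $Pa(X_i)$ contain a redundant variable. $r(N)$ denotes the reduced CP-net (the reduced form of $N$) obtained from $N$ by iterating the removal of redundant variables from parent sets until none is left. **Games.** A strategic game with parametrized preferences for $n$ players consists of a finite non-empty set $S_i$ of strategies for each player $i$ and, for each $i$ and each $s_{-i}\in S_{-i} := \prod_{j\ne i} S_j$, a preference $\succ(s_{-i})$ on $S_i$. **The game $\mathcal{G}(N)$.** Given a CP-net $N$, $\mathcal{G}(N)$ has one player $i$ for each variable $X_i$, with strategy set $S_i=\mathcal{D}(X_i)$. For a joint strategy $a_{-i}$ of the opponents of player $i$, the preference of player $i$ is $\succ(a_{-i}) := \succ(a_I)$, where $I$ is the index sequence of $Pa(X_i)$, $a_I$ is the projection of $a_{-i}$ onto $I$, and $X_I=a_I:\succ(a_I)$ is the unique preference statement of $N$ for $X_i$ determined by $a_I$. **The CP-net $\mathcal{N}(G)$.** Given a game $G$ with $n$ players, $\mathcal{N}(G)$ has one variable $X_i$ for each player $i$, with $\mathcal{D}(X_i)=S_i$ and $Pa(X_i)=\{X_j : j\ne i\}$. For each joint strategy $s_{-i}$ of the opponents of player $i$, the preference statement for $X_i$ is $X_{-i}=s_{-i}:\ \succ(s_{-i})$,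 where $\succ(s_{-i})$ is the preference of player $i$ in $G$ associated with $s_{-i}$. (The variable corresponding to player $i$ of $\mathcal{G}(N)$ is identified with the variable $X_i$ of $N$.) *)

theory Defs
  imports "HOL-Library.FuncSet"
begin

text \<open>Preferences are relations, with \<open>(x, y) \<in> r\<close> read as ``x is preferred to y''. The library
  notion \<^const>\<open>strict_linear_order_on\<close> does not confine the relation to the carrier.\<close>

definition preference_on :: "'a set \<Rightarrow> 'a rel \<Rightarrow> bool" where
  "preference_on A r \<longleftrightarrow> r \<subseteq> A \<times> A \<and> strict_linear_order_on A r"

text \<open>The variable \<open>X\<^sub>i\<close> is represented by its index \<open>i \<in> {1..n}\<close>, and an assignment to the variables
  in \<open>J\<close> by an element of \<open>Pi\<^sub>E J (vdom N)\<close>, that is, a function which is \<^const>\<open>undefined\<close> outside \<open>J\<close>.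
  The preference statement \<open>X\<^sub>I = a : r\<close> for \<open>X\<^sub>i\<close> is \<open>cpref N i a = r\<close>.
  All components of a CP-net or a game are required to be extensional on their index sets, so
  that HOL equality of the records is equality of CP-nets and of games.\<close>

record 'a cpnet =
  nvars :: nat
  vdom :: "nat \<Rightarrow> 'a set"
  Pa :: "nat \<Rightarrow> nat set"
  cpref :: "nat \<Rightarrow> (nat \<Rightarrow> 'a) \<Rightarrow> 'a rel"

definition vars :: "'a cpnet \<Rightarrow> nat set" where
  "vars N = {1..nvars N}"

definition cp_net :: "'a cpnet \<Rightarrow> bool" where
  "cp_net N \<longleftrightarrow>
     vdom N \<in> (\<Pi>\<^sub>E i\<in>vars N. {A. finite A \<and> A \<noteq> {}}) \<and>
     Pa N \<in> (\<Pi>\<^sub>E i\<in>vars N. Pow (vars N - {i})) \<and>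
     cpref N \<in> (\<Pi>\<^sub>E i\<in>vars N. \<Pi>\<^sub>E a\<in>Pi\<^sub>E (Pa N i) (vdom N). {r. preference_on (vdom N i) r})"

definition outcomes :: "'a cpnet \<Rightarrow> (nat \<Rightarrow> 'a) set" where
  "outcomes N = Pi\<^sub>E (vars N) (vdom N)"

definition worsening_flip :: "'a cpnet \<Rightarrow> (nat \<Rightarrow> 'a) \<Rightarrow> (nat \<Rightarrow> 'a) \<Rightarrow> bool" where
  "worsening_flip N \<alpha> \<beta> \<longleftrightarrow>
     \<alpha> \<in> outcomes N \<and> \<beta> \<in> outcomes N \<and>
     (\<exists>i\<in>vars N. \<alpha> i \<noteq> \<beta> i \<and> (\<forall>j\<in>vars N - {i}. \<alpha> j = \<beta> j) \<and>
        (\<alpha> i, \<beta> i) \<in> cpref N i (restrict \<alpha> (Pa N i)))"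

definition outcome_order :: "'a cpnet \<Rightarrow> (nat \<Rightarrow> 'a) \<Rightarrow> (nat \<Rightarrow> 'a) \<Rightarrow> bool" where
  "outcome_order N = (worsening_flip N)\<^sup>+\<^sup>+"

definition redundant :: "'a cpnet \<Rightarrow> nat \<Rightarrow> nat \<Rightarrow> bool" where
  "redundant N i j \<longleftrightarrow>
     j \<in> Pa N i \<and>
     (\<forall>a\<in>Pi\<^sub>E (Pa N i - {j}) (vdom N). \<forall>y1\<in>vdom N j. \<forall>y2\<in>vdom N j.
        cpref N i (a(j := y1)) = cpref N i (a(j := y2)))"

definition remove_parent :: "'a cpnet \<Rightarrow> nat \<Rightarrow> nat \<Rightarrow> 'a cpnet" where
  "remove_parent N i j = N\<lparr>
     Pa := (Pa N)(i := Pa N i - {j}),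
     cpref := (cpref N)(i := \<lambda>a\<in>Pi\<^sub>E (Pa N i - {j}) (vdom N).
                THE r. \<forall>y\<in>vdom N j. cpref N i (a(j := y)) = r)\<rparr>"

definition reduction_step :: "'a cpnet \<Rightarrow> 'a cpnet \<Rightarrow> bool" where
  "reduction_step N N' \<longleftrightarrow> (\<exists>i\<in>vars N. \<exists>j. redundant N i j \<and> N' = remove_parent N i j)"

definition reduced :: "'a cpnet \<Rightarrow> bool" where
  "reduced N \<longleftrightarrow> (\<forall>i\<in>vars N. \<forall>j\<in>Pa N i. \<not> redundant N i j)"

text \<open>For a CP-net, every order of removals ends in the same reduced CP-net, so the description below
  is proper.\<close>

definition reduced_form :: "'a cpnet \<Rightarrow> 'a cpnet" where
  "reduced_form N = (THE N'. reduction_step\<^sup>*\<^sup>* N N' \<and> reduced N')"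

record 'a game =
  nplayers :: nat
  strat :: "nat \<Rightarrow> 'a set"
  gpref :: "nat \<Rightarrow> (nat \<Rightarrow> 'a) \<Rightarrow> 'a rel"

definition players :: "'a game \<Rightarrow> nat set" where
  "players G = {1..nplayers G}"

definition strategic_game :: "'a game \<Rightarrow> bool" where
  "strategic_game G \<longleftrightarrow>
     strat G \<in> (\<Pi>\<^sub>E i\<in>players G. {S. finite S \<and> S \<noteq> {}}) \<and>
     gpref G \<in> (\<Pi>\<^sub>E i\<in>players G. \<Pi>\<^sub>E s\<in>Pi\<^sub>E (players G - {i}) (strat G).
                  {r. preference_on (strat G i) r})"

definition game_of_cpnet :: "'a cpnet \<Rightarrow> 'a game" where
  "game_of_cpnet N = \<lparr>
     nplayers = nvars N,
     strat = vdom N,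
     gpref = (\<lambda>i\<in>vars N. \<lambda>s\<in>Pi\<^sub>E (vars N - {i}) (vdom N). cpref N i (restrict s (Pa N i)))\<rparr>"

definition cpnet_of_game :: "'a game \<Rightarrow> 'a cpnet" where
  "cpnet_of_game G = \<lparr>
     nvars = nplayers G,
     vdom = strat G,
     Pa = (\<lambda>i\<in>players G. players G - {i}),
     cpref = gpref G\<rparr>"

lemma strategic_game_game_of_cpnet:
  assumes "cp_net N"
  shows "strategic_game (game_of_cpnet N)"
proof -
  have P: "Pa N i \<subseteq> vars N - {i}" if "i \<in> vars N" for i
    using assms that by (auto simp: cp_net_def PiE_iff)
  have R: "preference_on (vdom N i) (cpref N i (restrict s (Pa N i)))"
    if i: "i \<in> vars N" and s: "s \<in> Pi\<^sub>E (vars N - {i}) (vdom N)" for i s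
  proof -
    have "restrict s (Pa N i) \<in> Pi\<^sub>E (Pa N i) (vdom N)"
      using s P[OF i] by (auto simp: PiE_iff)
    then show ?thesis
      using assms i by (auto simp: cp_net_def PiE_iff)
  qed
  have "players (game_of_cpnet N) = vars N"
    by (simp add: players_def vars_def game_of_cpnet_def)
  then show ?thesis
    using assms R
    by (simp add: strategic_game_def game_of_cpnet_def cp_net_def PiE_iff)
qed

lemma cp_net_cpnet_of_game:
  assumes "strategic_game G"
  shows "cp_net (cpnet_of_game G)"
proof -
  have V: "vars (cpnet_of_game G) = players G"
    by (simp add: vars_def players_def cpnet_of_game_def)
  show ?thesis
    using assms unfolding cp_net_def V
    by (auto simp: cpnet_of_game_def strategic_game_def PiE_iff)
qed

end

theory Submission
  imports Defs
begin

text \<open>A CP-net enters the ordering of its outcomes only through its game, and removing a redundant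
  parent does not change the game. Conversely, a reduced CP-net can be recovered from its game: a
  non-redundant parent of \<open>X\<^sub>i\<close> is a player whose strategy can influence the preference of player
  \<open>i\<close>, and every CP-net with the same game must have it as a parent. So a reduced form is unique,
  and all three claims follow.\<close>

section \<open>Games of CP-nets and extension of assignments\<close>

lemma vdom_nonempty: "cp_net N \<Longrightarrow> i \<in> vars N \<Longrightarrow> vdom N i \<noteq> {}"
  by (auto simp: cp_net_def PiE_iff)

lemma Pa_subset: "cp_net N \<Longrightarrow> i \<in> vars N \<Longrightarrow> Pa N i \<subseteq> vars N - {i}"
  by (auto simp: cp_net_def PiE_iff)

lemma game_of_cpnet_sel [simp]:
  "nplayers (game_of_cpnet N) = nvars N"
  "strat (game_of_cpnet N) = vdom N"
  by (simp_all add: game_of_cpnet_def)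

lemma players_game_of_cpnet [simp]: "players (game_of_cpnet N) = vars N"
  by (simp add: players_def vars_def)

lemma gpref_game_of_cpnet:
  assumes "i \<in> vars N" "s \<in> Pi\<^sub>E (vars N - {i}) (vdom N)"
  shows "gpref (game_of_cpnet N) i s = cpref N i (restrict s (Pa N i))"
  using assms by (simp add: game_of_cpnet_def)

text \<open>Domains are non-empty, so the missing coordinates can be filled arbitrarily. This links
  the two kinds of preference table: those of a CP-net take assignments to parents, those of its
  game take joint strategies of all opponents.\<close>

lemma extend_assignment:
  assumes N: "cp_net N" and J: "J \<subseteq> K" "K \<subseteq> vars N" and a: "a \<in> Pi\<^sub>E J (vdom N)"
  obtains s where "s \<in> Pi\<^sub>E K (vdom N)" "restrict s J = a"
proof -
  define s where "s = (\<lambda>k\<in>K. if k \<in> J then a k else SOME y. y \<in> vdom N k)"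
  have "s \<in> Pi\<^sub>E K (vdom N)"
    using a J vdom_nonempty[OF N] by (auto simp: s_def PiE_iff some_in_eq)
  moreover have "restrict s J = a"
    using a J by (auto simp: s_def PiE_iff extensional_def restrict_def fun_eq_iff)
  ultimately show thesis
    by (rule that)
qed

section \<open>The ordering of outcomes as a function of the game\<close>

lemma worsening_flip_game:
  assumes "cp_net N"
  shows "worsening_flip N \<alpha> \<beta> \<longleftrightarrow>
     \<alpha> \<in> outcomes N \<and> \<beta> \<in> outcomes N \<and>
     (\<exists>i\<in>vars N. \<alpha> i \<noteq> \<beta> i \<and> (\<forall>j\<in>vars N - {i}. \<alpha> j = \<beta> j) \<and>
        (\<alpha> i, \<beta> i) \<in> gpref (game_of_cpnet N) i (restrict \<alpha> (vars N - {i})))"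
proof -
  have "gpref (game_of_cpnet N) i (restrict \<alpha> (vars N - {i})) = cpref N i (restrict \<alpha> (Pa N i))"
    if "\<alpha> \<in> outcomes N" "i \<in> vars N" for i
  proof -
    have "restrict \<alpha> (vars N - {i}) \<in> Pi\<^sub>E (vars N - {i}) (vdom N)"
      using that by (auto simp: outcomes_def PiE_iff)
    \<comment> \<open>No variable is its own parent, so projecting first to the opponents of
      \<open>i\<close> loses nothing that the parents of \<open>i\<close> see.\<close>
    moreover have "(vars N - {i}) \<inter> Pa N i = Pa N i"
      using Pa_subset[OF assms] that by blast
    ultimately show ?thesis
      using that by (simp add: gpref_game_of_cpnet)
  qed
  then show ?thesis
    unfolding worsening_flip_def by blast
qed

lemma outcomes_eq_if_same_game:
  assumes "game_of_cpnet N = game_of_cpnet N'"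
  shows "outcomes N = outcomes N'"
  using assms by (metis game_of_cpnet_sel(2) outcomes_def players_game_of_cpnet)

lemma outcome_order_eq_if_same_game:
  assumes "cp_net N" "cp_net N'" "game_of_cpnet N = game_of_cpnet N'"
  shows "outcome_order N = outcome_order N'"
proof -
  have "vars N = vars N'"
    using assms(3) by (metis players_game_of_cpnet)
  then have "worsening_flip N = worsening_flip N'"
    using outcomes_eq_if_same_game[OF assms(3)] assms
    by (simp add: fun_eq_iff worsening_flip_game)
  then show ?thesis
    by (simp add: outcome_order_def)
qed

section \<open>Recovering a reduced CP-net from its game\<close>

lemma reduced_Pa_subset:
  assumes N: "cp_net N" "reduced N"
    and G: "game_of_cpnet N = game_of_cpnet N'" and i: "i \<in> vars N"
  shows "Pa N i \<subseteq> Pa N' i"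
proof
  fix j assume j: "j \<in> Pa N i"
  have V: "vars N' = vars N" and D: "vdom N' = vdom N"
    using G by (metis players_game_of_cpnet, metis game_of_cpnet_sel(2))
  have "\<not> redundant N i j"
    using N(2) i j by (simp add: reduced_def)
  then obtain a y1 y2 where a: "a \<in> Pi\<^sub>E (Pa N i - {j}) (vdom N)"
    and y: "y1 \<in> vdom N j" "y2 \<in> vdom N j"
    and neq: "cpref N i (a(j := y1)) \<noteq> cpref N i (a(j := y2))"
    using j unfolding redundant_def by metis
  \<comment> \<open>The game needs a strategy for every opponent, so \<open>a\<close> is completed
    to \<open>s\<close>. Its value at \<open>j\<close> is overwritten by \<open>y1\<close> and
    \<open>y2\<close> below.\<close>
  obtain s where s: "s \<in> Pi\<^sub>E (vars N - {i}) (vdom N)" and sa: "restrict s (Pa N i - {j}) = a"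
    using extend_assignment[OF N(1) _ _ a, of "vars N - {i}"] Pa_subset[OF N(1) i] by blast
  have jV: "j \<in> vars N - {i}"
    using j Pa_subset[OF N(1) i] by blast
  have s_upd: "s(j := y) \<in> Pi\<^sub>E (vars N - {i}) (vdom N)" if "y \<in> vdom N j" for y
    using s jV that by (auto simp: PiE_iff extensional_def)
  have restr: "restrict (s(j := y)) (Pa N i) = a(j := y)" for y
    using j by (auto simp: sa[symmetric] restrict_def fun_eq_iff)
  have "gpref (game_of_cpnet N) i (s(j := y)) = cpref N i (a(j := y))" if "y \<in> vdom N j" for y
    using gpref_game_of_cpnet[OF i s_upd[OF that]] restr by simp
  with neq y have "gpref (game_of_cpnet N') i (s(j := y1)) \<noteq> gpref (game_of_cpnet N') i (s(j := y2))"
    using G by simp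
  \<comment> \<open>The game of \<open>N'\<close> looks at a joint strategy only through
    \<open>Pa N' i\<close>. The two strategies agree off \<open>j\<close>, so their projections can
    differ only if \<open>j\<close> lies in that set.\<close>
  then have "restrict (s(j := y1)) (Pa N' i) \<noteq> restrict (s(j := y2)) (Pa N' i)"
    using i s_upd y V D by (auto simp: gpref_game_of_cpnet)
  then show "j \<in> Pa N' i"
    by (auto simp: restrict_def fun_eq_iff split: if_splits)
qed

text \<open>Every assignment to the parents is the projection of some joint strategy of the
  opponents, so each table entry occurs as a value of the common game. Extensionality settles the
  arguments outside the tables.\<close>

lemma cpref_eq_if_same_game:
  assumes N: "cp_net N" and N': "cp_net N'" and G: "game_of_cpnet N = game_of_cpnet N'"
    and P: "Pa N = Pa N'"
  shows "cpref N = cpref N'"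
proof -
  have V: "vars N' = vars N" and D: "vdom N' = vdom N"
    using G by (metis players_game_of_cpnet, metis game_of_cpnet_sel(2))
  have "cpref N i a = cpref N' i a" if i: "i \<in> vars N" and a: "a \<in> Pi\<^sub>E (Pa N i) (vdom N)" for i a
  proof -
    obtain s where "s \<in> Pi\<^sub>E (vars N - {i}) (vdom N)" "restrict s (Pa N i) = a"
      using extend_assignment[OF N _ _ a, of "vars N - {i}"] Pa_subset[OF N i] by blast
    then show ?thesis
      using gpref_game_of_cpnet[of i N s] gpref_game_of_cpnet[of i N' s] i V D P G by simp
  qed
  moreover have "cpref N \<in> extensional (vars N)" "cpref N' \<in> extensional (vars N)"
    and "\<forall>i\<in>vars N. cpref N i \<in> extensional (Pi\<^sub>E (Pa N i) (vdom N))"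
      "\<forall>i\<in>vars N. cpref N' i \<in> extensional (Pi\<^sub>E (Pa N i) (vdom N))"
    using N N' V D P by (simp_all add: cp_net_def PiE_iff)
  ultimately show ?thesis
    by (metis extensionalityI)
qed

text \<open>This is injectivity of \<open>game_of_cpnet\<close> on reduced CP-nets:
  \<open>reduced_Pa_subset\<close>, used in both directions, makes the parent sets equal, and then
  the tables agree.\<close>

lemma reduced_eq_if_same_game:
  fixes N N' :: "'a cpnet"
  assumes "cp_net N" "reduced N" "cp_net N'" "reduced N'"
    and G: "game_of_cpnet N = game_of_cpnet N'"
  shows "N = N'"
proof -
  have V: "vars N' = vars N"
    using G by (metis players_game_of_cpnet)
  have "Pa N i = Pa N' i" if "i \<in> vars N" for i
    using reduced_Pa_subset[of N N' i] reduced_Pa_subset[of N' N i] assms that V by auto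
  moreover have "Pa N \<in> extensional (vars N)" "Pa N' \<in> extensional (vars N)"
    using assms V by (simp_all add: cp_net_def PiE_iff)
  ultimately have "Pa N = Pa N'"
    by (metis extensionalityI)
  moreover have "nvars N = nvars N'" "vdom N = vdom N'"
    using G by (metis game_of_cpnet_sel)+
  ultimately show ?thesis
    using cpref_eq_if_same_game[OF assms(1,3) G] by (intro cpnet.equality) auto
qed

section \<open>Removal of a redundant parent\<close>

lemma cpref_remove_parent:
  assumes red: "redundant N i j" and a: "a \<in> Pi\<^sub>E (Pa N i - {j}) (vdom N)"
    and y: "y \<in> vdom N j"
  shows "cpref (remove_parent N i j) i a = cpref N i (a(j := y))"
proof -
  have "cpref N i (a(j := y')) = cpref N i (a(j := y))" if "y' \<in> vdom N j" for y'
    using red a y that unfolding redundant_def by metis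
  \<comment> \<open>By redundancy all values of \<open>j\<close> yield one ordering; the existence
    of \<open>y\<close> makes the condition on \<open>r\<close> non-vacuous, hence the description
    unique.\<close>
  then have "(THE r. \<forall>y'\<in>vdom N j. cpref N i (a(j := y')) = r) = cpref N i (a(j := y))"
    using y by (intro the_equality) metis+
  then show ?thesis
    using a by (simp add: remove_parent_def)
qed

lemma remove_parent_sel [simp]:
  "nvars (remove_parent N i j) = nvars N"
  "vdom (remove_parent N i j) = vdom N"
  "Pa (remove_parent N i j) = (Pa N)(i := Pa N i - {j})"
  "vars (remove_parent N i j) = vars N"
  "k \<noteq> i \<Longrightarrow> cpref (remove_parent N i j) k = cpref N k"
  by (simp_all add: remove_parent_def vars_def)

lemma cp_net_remove_parent:
  assumes N: "cp_net N" and i: "i \<in> vars N" and red: "redundant N i j"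
  shows "cp_net (remove_parent N i j)"
proof -
  have j: "j \<in> Pa N i" "j \<in> vars N"
    using red Pa_subset[OF N i] by (auto simp: redundant_def)
  obtain y where y: "y \<in> vdom N j"
    using vdom_nonempty[OF N j(2)] by blast
  have pref: "preference_on (vdom N i) (cpref (remove_parent N i j) i a)"
    if a: "a \<in> Pi\<^sub>E (Pa N i - {j}) (vdom N)" for a
  proof -
    \<comment> \<open>Completed by \<open>y\<close>, the assignment indexes the old table, so each
      new entry is an old one and inherits being a preference.\<close>
    have "a(j := y) \<in> Pi\<^sub>E (Pa N i) (vdom N)"
      using a y j by (auto simp: PiE_iff extensional_def)
    then show ?thesis
      using N i by (auto simp: cpref_remove_parent[OF red a y] cp_net_def PiE_iff)
  qed
  have "cpref (remove_parent N i j) i \<in> extensional (Pi\<^sub>E (Pa N i - {j}) (vdom N))"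
    by (simp add: remove_parent_def)
  with pref have cpref_i: "cpref (remove_parent N i j) i \<in>
      (\<Pi>\<^sub>E a\<in>Pi\<^sub>E (Pa N i - {j}) (vdom N). {r. preference_on (vdom N i) r})"
    by (simp add: PiE_iff)
  have cpref_N: "cpref N k \<in>
      (\<Pi>\<^sub>E a\<in>Pi\<^sub>E (Pa N k) (vdom N). {r. preference_on (vdom N k) r})"
    if "k \<in> vars N" for k
    using N that unfolding cp_net_def by (elim conjE) (rule PiE_mem)
  have "cpref (remove_parent N i j) \<in>
      (\<Pi>\<^sub>E k\<in>vars N. \<Pi>\<^sub>E a\<in>Pi\<^sub>E (Pa (remove_parent N i j) k) (vdom N).
        {r. preference_on (vdom N k) r})"
  proof (rule PiE_I)
    fix k assume "k \<in> vars N"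
    then show "cpref (remove_parent N i j) k \<in>
        (\<Pi>\<^sub>E a\<in>Pi\<^sub>E (Pa (remove_parent N i j) k) (vdom N). {r. preference_on (vdom N k) r})"
      using cpref_i cpref_N by (cases "k = i") simp_all
  next
    fix k assume k: "k \<notin> vars N"
    then have "k \<noteq> i"
      using i by blast
    then show "cpref (remove_parent N i j) k = undefined"
      using N k by (simp add: cp_net_def PiE_iff extensional_def)
  qed
  moreover have "Pa (remove_parent N i j) \<in> (\<Pi>\<^sub>E k\<in>vars N. Pow (vars N - {k}))"
    using N i by (auto simp: cp_net_def PiE_iff extensional_def)
  ultimately show ?thesis
    using N unfolding cp_net_def remove_parent_sel(1,2,4) by blast
qed

lemma game_remove_parent:
  assumes N: "cp_net N" and i: "i \<in> vars N" and red: "redundant N i j"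
  shows "game_of_cpnet (remove_parent N i j) = game_of_cpnet N"
proof -
  have j: "j \<in> Pa N i" "j \<in> vars N - {i}"
    using red Pa_subset[OF N i] by (auto simp: redundant_def)
  have "cpref (remove_parent N i j) k (restrict s (Pa (remove_parent N i j) k)) =
      cpref N k (restrict s (Pa N k))" if s: "s \<in> Pi\<^sub>E (vars N - {k}) (vdom N)" for k s
  proof (cases "k = i")
    case True
    have "restrict s (Pa N i - {j}) \<in> Pi\<^sub>E (Pa N i - {j}) (vdom N)" "s j \<in> vdom N j"
      using s True Pa_subset[OF N i] j by (auto simp: PiE_iff)
    \<comment> \<open>Among the values that may be put back at \<open>j\<close>, the choice
      \<open>s j\<close> restores the original projection of \<open>s\<close>.\<close>
    moreover have "(restrict s (Pa N i - {j}))(j := s j) = restrict s (Pa N i)"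
      using j by (auto simp: restrict_def fun_eq_iff)
    ultimately show ?thesis
      using cpref_remove_parent[OF red] True by simp
  qed simp
  then show ?thesis
    unfolding game_of_cpnet_def by (auto intro!: restrict_ext simp del: remove_parent_sel(3))
qed

section \<open>Existence and uniqueness of the reduced form\<close>

lemma reduction_steps_invariant:
  assumes "reduction_step\<^sup>*\<^sup>* N N'" "cp_net N"
  shows "cp_net N' \<and> game_of_cpnet N' = game_of_cpnet N"
  using assms
proof induction
  case (step N' N'')
  then show ?case
    by (auto simp: reduction_step_def cp_net_remove_parent game_remove_parent)
qed simp

lemma reduction_terminates:
  assumes "cp_net N"
  shows "\<exists>N'. reduction_step\<^sup>*\<^sup>* N N' \<and> reduced N'"
  using assms
\<comment> \<open>The measure is the total number of parents; a removal lowers the summand of one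
  variable and keeps the others.\<close>
proof (induction "\<Sum>i\<in>vars N. card (Pa N i)" arbitrary: N rule: less_induct)
  case less
  show ?case
  proof (cases "reduced N")
    case False
    then obtain i j where i: "i \<in> vars N" and red: "redundant N i j"
      by (auto simp: reduced_def)
    have fin: "finite (vars N)"
      by (simp add: vars_def)
    have "finite (Pa N i)"
      using Pa_subset[OF less.prems i] fin by (meson finite_Diff finite_subset)
    moreover have "j \<in> Pa N i"
      using red by (simp add: redundant_def)
    ultimately have "card (Pa N i - {j}) < card (Pa N i)"
      by (rule card_Diff1_less)
    then have "(\<Sum>k\<in>vars N. card (Pa (remove_parent N i j) k)) < (\<Sum>k\<in>vars N. card (Pa N k))"
      using i fin by (intro sum_strict_mono_ex1) auto
    then obtain N' where "reduction_step\<^sup>*\<^sup>* (remove_parent N i j) N'" "reduced N'"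
      using less.hyps[of "remove_parent N i j"] cp_net_remove_parent[OF less.prems i red] by auto
    moreover have "reduction_step N (remove_parent N i j)"
      using i red by (auto simp: reduction_step_def)
    ultimately show ?thesis
      by (meson converse_rtranclp_into_rtranclp)
  qed auto
qed

lemma reduced_form:
  fixes N :: "'a cpnet"
  assumes N: "cp_net N"
  shows "cp_net (reduced_form N)" "reduced (reduced_form N)"
    "game_of_cpnet (reduced_form N) = game_of_cpnet N"
proof -
  have "\<exists>!N'. reduction_step\<^sup>*\<^sup>* N N' \<and> reduced N'"
  proof (rule ex_ex1I)
    show "\<exists>N'. reduction_step\<^sup>*\<^sup>* N N' \<and> reduced N'"
      by (rule reduction_terminates[OF N])
  next
    fix N1 N2
    assume "reduction_step\<^sup>*\<^sup>* N N1 \<and> reduced N1" "reduction_step\<^sup>*\<^sup>* N N2 \<and> reduced N2"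
    \<comment> \<open>Instead of a confluence argument: both endpoints are reduced and have the game
      of \<open>N\<close>, which determines them.\<close>
    then show "N1 = N2"
      using reduction_steps_invariant[OF _ N] by (metis reduced_eq_if_same_game)
  qed
  then have "reduction_step\<^sup>*\<^sup>* N (reduced_form N) \<and> reduced (reduced_form N)"
    unfolding reduced_form_def by (rule theI')
  then show "cp_net (reduced_form N)" "reduced (reduced_form N)"
    "game_of_cpnet (reduced_form N) = game_of_cpnet N"
    using reduction_steps_invariant[OF _ N] by blast+
qed

section \<open>From a game to a CP-net and back\<close>

lemma game_of_cpnet_of_game:
  fixes G :: "'a game"
  assumes "strategic_game G"
  shows "game_of_cpnet (cpnet_of_game G) = G"
proof -
  have V: "vars (cpnet_of_game G) = players G"
    by (simp add: vars_def players_def cpnet_of_game_def)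
  have E: "gpref G \<in> extensional (players G)"
    "\<forall>i\<in>players G. gpref G i \<in> extensional (Pi\<^sub>E (players G - {i}) (strat G))"
    using assms by (simp_all add: strategic_game_def PiE_iff)
  \<comment> \<open>All opponents are parents here, so projecting a joint strategy to the parents
    returns it unchanged; for other arguments both sides are \<open>undefined\<close>.\<close>
  have "gpref (game_of_cpnet (cpnet_of_game G)) i s = gpref G i s" for i s
    using E unfolding game_of_cpnet_def V
    by (auto simp: cpnet_of_game_def extensional_def PiE_restrict)
  then show ?thesis
    by (intro game.equality ext) (simp_all add: cpnet_of_game_def)
qed

theorem theorem3:
  shows "(\<forall>N :: 'a cpnet. cp_net N \<longrightarrow>
            outcomes N = outcomes (reduced_form N) \<and>
            outcome_order N = outcome_order (reduced_form N)) \<and>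
         (\<forall>N :: 'a cpnet. cp_net N \<longrightarrow>
            game_of_cpnet N = game_of_cpnet (reduced_form N)) \<and>
         (\<forall>N :: 'a cpnet. cp_net N \<and> reduced N \<longrightarrow>
            N = reduced_form (cpnet_of_game (game_of_cpnet N)))"
proof (intro conjI allI impI)
  fix N :: "'a cpnet"
  assume N: "cp_net N"
  show "game_of_cpnet N = game_of_cpnet (reduced_form N)"
    by (simp add: reduced_form[OF N])
  then show "outcomes N = outcomes (reduced_form N)"
    "outcome_order N = outcome_order (reduced_form N)"
    using outcomes_eq_if_same_game outcome_order_eq_if_same_game[OF N] reduced_form[OF N] by blast+
next
  fix N :: "'a cpnet"
  assume N: "cp_net N \<and> reduced N"
  then have game: "strategic_game (game_of_cpnet N)"
    by (simp add: strategic_game_game_of_cpnet)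
  then have "game_of_cpnet N = game_of_cpnet (reduced_form (cpnet_of_game (game_of_cpnet N)))"
    by (simp add: reduced_form cp_net_cpnet_of_game game_of_cpnet_of_game)
  \<comment> \<open>Both sides are reduced CP-nets with the same game.\<close>
  with N game show "N = reduced_form (cpnet_of_game (game_of_cpnet N))"
    by (simp add: reduced_eq_if_same_game reduced_form cp_net_cpnet_of_game)
qed

end
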